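(* Let $A, \hat{A}, X, \hat{X}$ be $N \times N$ complex matrices. Let $\hat{A}$ and $\hat{X}$ be block diagonal matrices with diagonal blocks $\hat{A}_1, \dots, \hat{A}_l$ and $\hat{X}_1,\dots,\hat{X}_l$ respectively, where, for each $i \in \{1,\dots,l\}$, $\hat{A}_i$ and $\hat{X}_i$ are $N_i \times N_i$ matrices and $N = \sum_{i=1}^l N_i$. Suppose that, for each $i$, $\hat{A}_i$ and $\hat{X}_i$ are commonly diagonalisable by a non-singular matrix $P_i$, i.e., $P_i \hat{A}_i P_i^{-1}$ and $P_i \hat{X}_i P_i^{-1}$ are both diagonal matrices. Let $$L = \begin{pmatrix} A & X \\ I & 0 \end{pmatrix} \quad\text{and}\quad \hat{L} = \begin{pmatrix} \hat{A} & \hat{X} \\ I & 0 \end{pmatrix}$$ be the corresponding $2N \times 2N$ matrices, where $I$ and $0$ are the $N\times N$ identity and zero matrices. Then, for any eigenvalue $\mu$ of $L$, there exists an eigenvalue $\nu$ of $\hat{L}$ such that $$| \mu - \nu | \leq \sqrt{\max_{1\le i\le l} \kappa (P_i)} \cdot \sqrt{\| X-\hat{X} + \mu (A-\hat{A})\|_2}.$$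
   Context: $\|\cdot\|_2$ denotes the spectral norm of a matrix (the operator norm induced by the Euclidean norm). For a non-singular matrix $P$, the condition number is $\kappa(P) = \| P \|_2 \cdot \| P^{-1} \|_2$. Eigenvalues are understood as complex numbers. *)

theory Defs
  imports
    "HOL-Analysis.L2_Norm"
    "Jordan_Normal_Form.Char_Poly"
    "Jordan_Normal_Form.Gauss_Jordan_Elimination"
begin

definition vec_norm2 :: "complex vec \<Rightarrow> real" where
  "vec_norm2 v = L2_set (\<lambda>i. cmod (v $ i)) {..<dim_vec v}"

(* The supremum runs over the closed unit ball, so the set contains 0 and is bounded also for
   matrices without columns; the norm of a 0 x 0 matrix is 0. *)
definition spectral_norm :: "complex mat \<Rightarrow> real" where
  "spectral_norm M =
    (SUP v \<in> {v \<in> carrier_vec (dim_col M). vec_norm2 v \<le> 1}. vec_norm2 (M *\<^sub>v v))"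

(* Total version of the library's option-valued mat_inverse; unspecified for singular matrices. *)
definition inv_mat :: "complex mat \<Rightarrow> complex mat" where
  "inv_mat P = the (mat_inverse P)"

definition cond_number :: "complex mat \<Rightarrow> real" where
  "cond_number P = spectral_norm P * spectral_norm (inv_mat P)"

end

theory Submission
  imports Defs "Jordan_Normal_Form.Spectral_Radius"
begin

text \<open>An eigenvector of \<open>L\<close> for \<open>\<mu>\<close> has the form \<open>(\<mu> v, v)\<close>, where \<open>v\<close> is in the kernel of the quadratic
  pencil \<open>\<mu>\<^sup>2 - \<mu> A - X\<close>; hence the pencil of \<open>A_hat\<close>, \<open>X_hat\<close> maps \<open>v\<close> to the perturbation
  \<open>X - X_hat + \<mu> (A - A_hat)\<close> applied to \<open>v\<close>. After conjugation with \<open>P i\<close>, the \<open>i\<close>-th block of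
  the pencil of \<open>A_hat\<close>, \<open>X_hat\<close> is diagonal with entries \<open>(\<mu> - r) (\<mu> - s)\<close>, where \<open>r\<close> and \<open>s\<close> are eigenvalues of \<open>L_hat\<close>.
  So, with \<open>\<rho>\<close> the distance of \<open>\<mu>\<close> to the spectrum of \<open>L_hat\<close>, the block expands norms
  by at least \<open>\<rho>\<^sup>2 / cond_number (P i)\<close>. Squaring and summing the block estimates keeps the
  maximal condition number rather than that of the block diagonal matrix of all \<open>P i\<close>.\<close>

section \<open>Euclidean and spectral norm\<close>

lemma vec_norm2_nonneg [simp]: "0 \<le> vec_norm2 v"
  by (simp add: vec_norm2_def L2_set_nonneg)

lemma vec_norm2_zero [simp]: "vec_norm2 (0\<^sub>v n) = 0"
  by (simp add: vec_norm2_def L2_set_def)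

lemma vec_norm2_power2: "(vec_norm2 v)\<^sup>2 = (\<Sum>i<dim_vec v. (cmod (v $ i))\<^sup>2)"
  by (simp add: vec_norm2_def L2_set_def sum_nonneg)

lemma vec_norm2_pos:
  assumes "v \<noteq> 0\<^sub>v (dim_vec v)"
  shows "0 < vec_norm2 v"
proof (rule ccontr)
  assume "\<not> 0 < vec_norm2 v"
  then have "vec_norm2 v = 0"
    using vec_norm2_nonneg[of v] by linarith
  then have "\<forall>i<dim_vec v. v $ i = 0"
    by (simp add: vec_norm2_def L2_set_eq_0_iff)
  then show False using assms by auto
qed

lemma vec_norm2_smult: "vec_norm2 (c \<cdot>\<^sub>v v) = cmod c * vec_norm2 v"
  by (auto simp: vec_norm2_def norm_mult L2_set_right_distrib intro!: L2_set_cong)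

lemma cmod_index_le_vec_norm2: "i < dim_vec v \<Longrightarrow> cmod (v $ i) \<le> vec_norm2 v"
  unfolding vec_norm2_def by (rule member_le_L2_set) auto

text \<open>Pythagoras for a stacked vector; this is what makes squared block estimates
  additive.\<close>

lemma vec_norm2_append_power2:
  "(vec_norm2 (u @\<^sub>v v))\<^sup>2 = (vec_norm2 u)\<^sup>2 + (vec_norm2 v)\<^sup>2"
proof -
  let ?m = "dim_vec u" and ?n = "dim_vec v"
  let ?f = "\<lambda>i. (cmod ((u @\<^sub>v v) $ i))\<^sup>2"
  have "sum ?f {..<?m + ?n} = sum ?f {..<?m} + sum ?f {?m..<?m + ?n}"
    by (subst sum.union_disjoint[symmetric]) (auto intro: sum.cong)
  also have "sum ?f {?m..<?m + ?n} = (\<Sum>i<?n. ?f (i + ?m))"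
    using sum.shift_bounds_nat_ivl[of ?f 0 ?m ?n] by (simp add: atLeast0LessThan add.commute)
  finally show ?thesis
    by (simp add: vec_norm2_power2)
qed

lemma vec_norm2_mono_scaled:
  assumes "dim_vec u = dim_vec v"
    and "\<And>i. i < dim_vec v \<Longrightarrow> c * cmod (u $ i) \<le> cmod (v $ i)" and "0 \<le> c"
  shows "c * vec_norm2 u \<le> vec_norm2 v"
  using assms by (auto simp: vec_norm2_def L2_set_right_distrib intro!: L2_set_mono)

text \<open>On the unit ball every coordinate has modulus at most 1, so the sum of the moduli of all
  entries is a bound. Boundedness is what makes the supremum in \<open>spectral_norm\<close> an
  upper bound.\<close>

lemma bdd_above_unit_ball_image:
  "bdd_above ((\<lambda>v. vec_norm2 (M *\<^sub>v v)) ` {v \<in> carrier_vec (dim_col M). vec_norm2 v \<le> 1})"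
proof (rule bdd_aboveI2)
  fix v assume v: "v \<in> {v \<in> carrier_vec (dim_col M). vec_norm2 v \<le> 1}"
  have "vec_norm2 (M *\<^sub>v v) \<le> (\<Sum>i<dim_row M. cmod ((M *\<^sub>v v) $ i))"
    unfolding vec_norm2_def by (rule order_trans[OF L2_set_le_sum]) auto
  also have "\<dots> \<le> (\<Sum>i<dim_row M. \<Sum>j<dim_col M. cmod (M $$ (i, j)))"
  proof (rule sum_mono)
    fix i assume i: "i \<in> {..<dim_row M}"
    have "(M *\<^sub>v v) $ i = (\<Sum>j<dim_col M. M $$ (i, j) * v $ j)"
      using v i by (auto simp: scalar_prod_def atLeast0LessThan)
    also have "cmod \<dots> \<le> (\<Sum>j<dim_col M. cmod (M $$ (i, j)))"
    proof (rule sum_norm_le)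
      fix j assume "j \<in> {..<dim_col M}"
      then have "cmod (v $ j) \<le> 1"
        using v cmod_index_le_vec_norm2[of j v] by auto
      then show "cmod (M $$ (i, j) * v $ j) \<le> cmod (M $$ (i, j))"
        by (simp add: norm_mult mult_left_le)
    qed
    finally show "cmod ((M *\<^sub>v v) $ i) \<le> (\<Sum>j<dim_col M. cmod (M $$ (i, j)))" .
  qed
  finally show "vec_norm2 (M *\<^sub>v v) \<le> (\<Sum>i<dim_row M. \<Sum>j<dim_col M. cmod (M $$ (i, j)))" .
qed

lemma spectral_norm_nonneg: "0 \<le> spectral_norm M"
proof -
  have "vec_norm2 (M *\<^sub>v 0\<^sub>v (dim_col M)) \<le> spectral_norm M"
    unfolding spectral_norm_def by (rule cSUP_upper[OF _ bdd_above_unit_ball_image]) simp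
  then show ?thesis
    using vec_norm2_nonneg order_trans by blast
qed

text \<open>Scaling \<open>v\<close> to norm 1 puts it into the ball of the supremum; the zero
  vector, which cannot be scaled, is treated apart.\<close>

lemma vec_norm2_mult_mat_vec_le:
  assumes v: "v \<in> carrier_vec (dim_col M)"
  shows "vec_norm2 (M *\<^sub>v v) \<le> spectral_norm M * vec_norm2 v"
proof (cases "v = 0\<^sub>v (dim_col M)")
  case True
  have "M *\<^sub>v v = 0\<^sub>v (dim_row M)"
    unfolding True by (intro eq_vecI) auto
  then show ?thesis by (simp add: True)
next
  case False
  define c where "c = vec_norm2 v"
  have c: "0 < c"
    unfolding c_def using False v by (intro vec_norm2_pos) auto
  define u where "u = complex_of_real (1 / c) \<cdot>\<^sub>v v"
  have u: "u \<in> carrier_vec (dim_col M)" "vec_norm2 u = 1"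
    using v c by (auto simp: u_def vec_norm2_smult c_def norm_divide)
  have "vec_norm2 (M *\<^sub>v u) \<le> spectral_norm M"
    unfolding spectral_norm_def by (rule cSUP_upper[OF _ bdd_above_unit_ball_image]) (simp add: u)
  moreover have "M *\<^sub>v u = complex_of_real (1 / c) \<cdot>\<^sub>v (M *\<^sub>v v)"
    unfolding u_def using v by (intro mult_mat_vec) auto
  ultimately have "vec_norm2 (M *\<^sub>v v) / c \<le> spectral_norm M"
    using c by (simp add: vec_norm2_smult norm_divide)
  then show ?thesis
    using c by (simp add: divide_le_eq c_def)
qed

section \<open>Block diagonal matrices\<close>

lemma diag_block_mat_square_carrier:
  assumes "\<And>B. B \<in> set Bs \<Longrightarrow> square_mat B"
  shows "diag_block_mat Bs \<in> carrier_mat (dim_row (diag_block_mat Bs)) (dim_row (diag_block_mat Bs))"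
  using diag_block_mat_square[of Bs] assms by auto

lemma diag_block_mat_map_carrier:
  assumes "\<And>i. i \<in> set is \<Longrightarrow> B i \<in> carrier_mat (n i) (n i)"
  shows "diag_block_mat (map B is) \<in> carrier_mat (\<Sum>i\<leftarrow>is. n i) (\<Sum>i\<leftarrow>is. n i)"
  using assms by (induction "is") (auto simp: Let_def)

lemma diag_block_mat_Cons_mult_vec:
  assumes "B \<in> carrier_mat m m" and "diag_block_mat Bs \<in> carrier_mat k k"
    and "u \<in> carrier_vec m" and "v \<in> carrier_vec k"
  shows "diag_block_mat (B # Bs) *\<^sub>v (u @\<^sub>v v) = (B *\<^sub>v u) @\<^sub>v (diag_block_mat Bs *\<^sub>v v)"
  using mult_mat_vec_split[OF assms] assms by (simp add: Let_def)

text \<open>The block inequalities are squared and added by Pythagoras, so the constants do not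
  deteriorate with the number of blocks. Keeping \<kappa> as a factor on the right avoids a
  division: the condition number of a 0 x 0 block is 0.\<close>

lemma diag_block_mat_bounded_below:
  assumes "\<And>B. B \<in> set Bs \<Longrightarrow> square_mat B"
    and "\<And>B v. B \<in> set Bs \<Longrightarrow> v \<in> carrier_vec (dim_row B) \<Longrightarrow>
      \<delta> * vec_norm2 v \<le> \<kappa> * vec_norm2 (B *\<^sub>v v)"
    and "0 \<le> \<delta>" and "0 \<le> \<kappa>"
    and "v \<in> carrier_vec (dim_row (diag_block_mat Bs))"
  shows "\<delta> * vec_norm2 v \<le> \<kappa> * vec_norm2 (diag_block_mat Bs *\<^sub>v v)"
  using assms
proof (induction Bs arbitrary: v)
  case Nil
  then show ?case by (auto simp: vec_norm2_def)
next
  case (Cons B Bs)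
  define m k where "m = dim_row B" and "k = dim_row (diag_block_mat Bs)"
  have B: "B \<in> carrier_mat m m"
    using Cons.prems(1)[of B] by (auto simp: m_def)
  have D: "diag_block_mat Bs \<in> carrier_mat k k"
    unfolding k_def using Cons.prems(1) by (intro diag_block_mat_square_carrier) auto
  have "v \<in> carrier_vec (m + k)"
    using Cons.prems(5) by (auto simp: m_def k_def Let_def)
  then obtain u w where v: "v = u @\<^sub>v w" and u: "u \<in> carrier_vec m" and w: "w \<in> carrier_vec k"
    by (metis vec_first_last_append vec_first_carrier vec_last_carrier)
  have *: "(\<delta> * vec_norm2 u)\<^sup>2 \<le> (\<kappa> * vec_norm2 (B *\<^sub>v u))\<^sup>2"
    using Cons.prems(2)[of B u] u Cons.prems(3) by (intro power_mono) (auto simp: m_def)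
  have **: "(\<delta> * vec_norm2 w)\<^sup>2 \<le> (\<kappa> * vec_norm2 (diag_block_mat Bs *\<^sub>v w))\<^sup>2"
    using Cons.IH[of w] Cons.prems w by (intro power_mono) (auto simp: k_def)
  have "(\<delta> * vec_norm2 v)\<^sup>2 \<le> (\<kappa> * vec_norm2 (diag_block_mat (B # Bs) *\<^sub>v v))\<^sup>2"
    unfolding v diag_block_mat_Cons_mult_vec[OF B D u w]
    using * ** by (simp add: power_mult_distrib vec_norm2_append_power2 distrib_left)
  then show ?case
    by (rule power2_le_imp_le) (simp add: Cons.prems)
qed

text \<open>A kernel vector of one block is padded with zeros. This is how an eigenvalue found in a
  single block becomes an eigenvalue of \<open>L_hat\<close>.\<close>

lemma diag_block_mat_kernel:
  assumes "\<And>B. B \<in> set Bs \<Longrightarrow> square_mat B"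
    and "B \<in> set Bs" and "v \<in> carrier_vec (dim_row B)" and "v \<noteq> 0\<^sub>v (dim_row B)"
    and "B *\<^sub>v v = 0\<^sub>v (dim_row B)"
  shows "\<exists>w \<in> carrier_vec (dim_row (diag_block_mat Bs)). w \<noteq> 0\<^sub>v (dim_row (diag_block_mat Bs)) \<and>
    diag_block_mat Bs *\<^sub>v w = 0\<^sub>v (dim_row (diag_block_mat Bs))"
  using assms
proof (induction Bs)
  case Nil
  then show ?case by simp
next
  case (Cons C Bs)
  define m k where "m = dim_row C" and "k = dim_row (diag_block_mat Bs)"
  have C: "C \<in> carrier_mat m m"
    using Cons.prems(1)[of C] by (auto simp: m_def)
  have D: "diag_block_mat Bs \<in> carrier_mat k k"
    unfolding k_def using Cons.prems(1) by (intro diag_block_mat_square_carrier) auto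
  have dim: "dim_row (diag_block_mat (C # Bs)) = m + k"
    by (simp add: m_def k_def Let_def)
  have zero: "0\<^sub>v (m + k) = 0\<^sub>v m @\<^sub>v 0\<^sub>v k"
    by (intro eq_vecI) auto
  \<comment> \<open>If the head is \<open>B\<close> itself, \<open>v\<close> is followed by zeros;
    otherwise \<open>B\<close> lies in the tail and zeros precede the vector from the induction
    hypothesis.\<close>
  obtain u w where uw: "u \<in> carrier_vec m" "w \<in> carrier_vec k" "u \<noteq> 0\<^sub>v m \<or> w \<noteq> 0\<^sub>v k"
    "C *\<^sub>v u = 0\<^sub>v m" "diag_block_mat Bs *\<^sub>v w = 0\<^sub>v k"
  proof (cases "B = C")
    case True
    have "diag_block_mat Bs *\<^sub>v 0\<^sub>v k = 0\<^sub>v k"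
      using D by (intro eq_vecI) auto
    with True Cons.prems that[of v "0\<^sub>v k"] show ?thesis
      by (auto simp: m_def)
  next
    case False
    have "C *\<^sub>v 0\<^sub>v m = 0\<^sub>v m"
      using C by (intro eq_vecI) auto
    with False Cons that[of "0\<^sub>v m"] show ?thesis
      by (auto simp: k_def)
  qed
  have "diag_block_mat (C # Bs) *\<^sub>v (u @\<^sub>v w) = 0\<^sub>v (m + k)"
    unfolding diag_block_mat_Cons_mult_vec[OF C D uw(1,2)] uw(4,5) zero ..
  moreover have "u @\<^sub>v w \<noteq> 0\<^sub>v (m + k)"
    unfolding zero append_vec_eq[OF uw(1) zero_carrier_vec] using uw(3) by blast
  ultimately show ?case
    unfolding dim using uw(1,2) by (intro bexI[of _ "u @\<^sub>v w"]) auto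
qed

section \<open>The quadratic pencil of a companion linearisation\<close>

text \<open>For square \<open>A\<close> and \<open>X\<close> of equal size, the determinant of this
  pencil is the characteristic polynomial of the block matrix with rows \<open>A\<close>,
  \<open>X\<close> and identity, zero.\<close>

definition quad_pencil :: "'a :: comm_ring_1 mat \<Rightarrow> 'a mat \<Rightarrow> 'a \<Rightarrow> 'a mat" where
  "quad_pencil A X z = z\<^sup>2 \<cdot>\<^sub>m 1\<^sub>m (dim_row A) - z \<cdot>\<^sub>m A - X"

text \<open>Matrix subtraction takes its dimensions from the second operand, so \<open>X\<close>
  fixes the size.\<close>

lemma quad_pencil_carrier [simp]:
  "X \<in> carrier_mat N N \<Longrightarrow> quad_pencil A X z \<in> carrier_mat N N"
  unfolding quad_pencil_def by (rule minus_carrier_mat)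

lemma index_quad_pencil:
  assumes "A \<in> carrier_mat N N" and "X \<in> carrier_mat N N" and "i < N" and "j < N"
  shows "quad_pencil A X z $$ (i, j) = (if i = j then z\<^sup>2 else 0) - z * A $$ (i, j) - X $$ (i, j)"
  using assms by (simp add: quad_pencil_def)

lemma quad_pencil_mult_vec:
  assumes A: "A \<in> carrier_mat N N" and X: "X \<in> carrier_mat N N" and v: "v \<in> carrier_vec N"
  shows "quad_pencil A X z *\<^sub>v v = z\<^sup>2 \<cdot>\<^sub>v v - z \<cdot>\<^sub>v (A *\<^sub>v v) - X *\<^sub>v v"
proof -
  have "z\<^sup>2 \<cdot>\<^sub>m 1\<^sub>m N *\<^sub>v v = z\<^sup>2 \<cdot>\<^sub>v v"
    using v by (intro eq_vecI) auto
  moreover have "z \<cdot>\<^sub>m A *\<^sub>v v = z \<cdot>\<^sub>v (A *\<^sub>v v)"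
    using A v by (intro eq_vecI) auto
  ultimately show ?thesis
    using assms by (simp add: quad_pencil_def
        minus_mult_distrib_mat_vec[of _ N N] minus_carrier_mat)
qed

text \<open>The lower block row of the eigenvector equation for \<open>u @\<^sub>v v\<close> forces
  \<open>u = z \<cdot>\<^sub>v v\<close>; substituted into the upper row it leaves the pencil
  equation for \<open>v\<close>.\<close>

lemma eigenvalue_companion_iff:
  fixes A X :: "'a :: field mat"
  assumes A: "A \<in> carrier_mat N N" and X: "X \<in> carrier_mat N N"
  shows "eigenvalue (four_block_mat A X (1\<^sub>m N) (0\<^sub>m N N)) z \<longleftrightarrow>
    (\<exists>v \<in> carrier_vec N. v \<noteq> 0\<^sub>v N \<and> quad_pencil A X z *\<^sub>v v = 0\<^sub>v N)" (is "eigenvalue ?L z \<longleftrightarrow> ?R")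
proof -
  have zero: "0\<^sub>v (N + N) = 0\<^sub>v N @\<^sub>v (0\<^sub>v N :: 'a vec)"
    by (intro eq_vecI) auto
  have step: "?L *\<^sub>v (u @\<^sub>v v) = z \<cdot>\<^sub>v (u @\<^sub>v v) \<longleftrightarrow> u = z \<cdot>\<^sub>v v \<and> quad_pencil A X z *\<^sub>v v = 0\<^sub>v N"
    if u: "u \<in> carrier_vec N" and v: "v \<in> carrier_vec N" for u v
  proof -
    have "?L *\<^sub>v (u @\<^sub>v v) = (A *\<^sub>v u + X *\<^sub>v v) @\<^sub>v u"
      using u v A X
      by (subst four_block_mat_mult_vec[of _ N N _ N _ N]) auto
    moreover have "z \<cdot>\<^sub>v (u @\<^sub>v v) = (z \<cdot>\<^sub>v u) @\<^sub>v (z \<cdot>\<^sub>v v)"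
      using u v by (intro eq_vecI) auto
    ultimately have "?L *\<^sub>v (u @\<^sub>v v) = z \<cdot>\<^sub>v (u @\<^sub>v v) \<longleftrightarrow>
        A *\<^sub>v u + X *\<^sub>v v = z \<cdot>\<^sub>v u \<and> u = z \<cdot>\<^sub>v v"
      using A X u v by (simp add: append_vec_eq[of _ N])
    also have "\<dots> \<longleftrightarrow> u = z \<cdot>\<^sub>v v \<and> quad_pencil A X z *\<^sub>v v = 0\<^sub>v N"
    \<comment> \<open>The lower row is moved to the front, so that the upper row may be rewritten
      under the assumption \<open>u = z \<cdot>\<^sub>v v\<close>.\<close>
    proof (rule conj_commute[THEN trans], rule conj_cong[OF refl])
      assume uz: "u = z \<cdot>\<^sub>v v"
      have "A *\<^sub>v u = z \<cdot>\<^sub>v (A *\<^sub>v v)"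
        unfolding uz using A v by (rule mult_mat_vec)
      \<comment> \<open>The entrywise form of the equivalence: \<open>a\<close>, \<open>b\<close>,
        \<open>c\<close> stand for entries of \<open>z \<cdot>\<^sub>v (A *\<^sub>v v)\<close>,
        \<open>X *\<^sub>v v\<close> and \<open>v\<close>.\<close>
      moreover have "a + b = z * (z * c) \<longleftrightarrow> z\<^sup>2 * c - a = b" for a b c :: 'a
        by (auto simp: power2_eq_square algebra_simps)
      ultimately show "A *\<^sub>v u + X *\<^sub>v v = z \<cdot>\<^sub>v u \<longleftrightarrow> quad_pencil A X z *\<^sub>v v = 0\<^sub>v N"
        unfolding quad_pencil_mult_vec[OF A X v] uz vec_eq_iff
        using A X v by (auto simp del: index_mult_mat_vec)
    qed
    finally show ?thesis .
  qed
  have dim: "dim_row ?L = N + N" using A by simp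
  show ?thesis
  proof
    assume "eigenvalue ?L z"
    then obtain x where x: "x \<in> carrier_vec (N + N)" "x \<noteq> 0\<^sub>v (N + N)" "?L *\<^sub>v x = z \<cdot>\<^sub>v x"
      unfolding eigenvalue_def eigenvector_def dim by blast
    then obtain u v where uv: "x = u @\<^sub>v v" "u \<in> carrier_vec N" "v \<in> carrier_vec N"
      by (metis vec_first_last_append vec_first_carrier vec_last_carrier)
    have "u = z \<cdot>\<^sub>v v" "quad_pencil A X z *\<^sub>v v = 0\<^sub>v N"
      using step[OF uv(2,3)] x(3) uv(1) by auto
    \<comment> \<open>A zero \<open>v\<close> would give \<open>u = z \<cdot>\<^sub>v v\<close>
      zero, hence \<open>x\<close> zero.\<close>
    moreover from this have "v \<noteq> 0\<^sub>v N"
      using x(2) unfolding uv(1) zero by auto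
    ultimately show ?R using uv(3) by blast
  next
    assume ?R
    then obtain v where v: "v \<in> carrier_vec N" "v \<noteq> 0\<^sub>v N" "quad_pencil A X z *\<^sub>v v = 0\<^sub>v N"
      by blast
    have "(z \<cdot>\<^sub>v v) @\<^sub>v v \<noteq> 0\<^sub>v (N + N)"
      unfolding zero using v by (subst append_vec_eq[of _ N]) auto
    with v step[of "z \<cdot>\<^sub>v v" v] show "eigenvalue ?L z"
      unfolding eigenvalue_def eigenvector_def dim
      by (intro exI[of _ "(z \<cdot>\<^sub>v v) @\<^sub>v v"]) auto
  qed
qed

text \<open>The identity term splits along the diagonal and zero off-diagonal blocks stay zero; this
  is the induction step for lists of blocks.\<close>

lemma quad_pencil_four_block_diag:
  assumes A: "A \<in> carrier_mat m m" and X: "X \<in> carrier_mat m m"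
    and B: "B \<in> carrier_mat k k" and Y: "Y \<in> carrier_mat k k"
  shows "quad_pencil (four_block_mat A (0\<^sub>m m k) (0\<^sub>m k m) B) (four_block_mat X (0\<^sub>m m k) (0\<^sub>m k m) Y) z =
    four_block_mat (quad_pencil A X z) (0\<^sub>m m k) (0\<^sub>m k m) (quad_pencil B Y z)"
    (is "quad_pencil ?AB ?XY z = ?F")
proof (rule eq_matI)
  have AB: "?AB \<in> carrier_mat (m + k) (m + k)" and XY: "?XY \<in> carrier_mat (m + k) (m + k)"
    using A X B Y by auto
  have F: "?F \<in> carrier_mat (m + k) (m + k)"
    using X Y by (intro four_block_carrier_mat quad_pencil_carrier)
  show "dim_row (quad_pencil ?AB ?XY z) = dim_row ?F" "dim_col (quad_pencil ?AB ?XY z) = dim_col ?F"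
    using quad_pencil_carrier[OF XY, of ?AB z] F by (metis carrier_matD)+
  fix i j assume "i < dim_row ?F" "j < dim_col ?F"
  then have ij: "i < m + k" "j < m + k" using F by auto
  show "quad_pencil ?AB ?XY z $$ (i, j) = ?F $$ (i, j)"
    using assms ij carrier_matD[OF quad_pencil_carrier[OF X, of A z]]
      carrier_matD[OF quad_pencil_carrier[OF Y, of B z]]
    by (auto simp: index_quad_pencil[OF AB XY] index_quad_pencil[OF A X] index_quad_pencil[OF B Y])
qed

lemma quad_pencil_diag_block_mat:
  assumes "\<And>i. i \<in> set is \<Longrightarrow> A i \<in> carrier_mat (n i) (n i)"
    and "\<And>i. i \<in> set is \<Longrightarrow> X i \<in> carrier_mat (n i) (n i)"
  shows "quad_pencil (diag_block_mat (map A is)) (diag_block_mat (map X is)) z =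
    diag_block_mat (map (\<lambda>i. quad_pencil (A i) (X i) z) is)"
  using assms
proof (induction "is")
  case Nil
  show ?case by (intro eq_matI) (auto simp: quad_pencil_def)
next
  case (Cons i "is")
  define k where "k = (\<Sum>j\<leftarrow>is. n j)"
  have A: "A i \<in> carrier_mat (n i) (n i)" and X: "X i \<in> carrier_mat (n i) (n i)"
    using Cons.prems by auto
  have As: "diag_block_mat (map A is) \<in> carrier_mat k k"
    and Xs: "diag_block_mat (map X is) \<in> carrier_mat k k"
    unfolding k_def using Cons.prems by (auto intro!: diag_block_mat_map_carrier)
  have IH: "diag_block_mat (map (\<lambda>i. quad_pencil (A i) (X i) z) is) =
      quad_pencil (diag_block_mat (map A is)) (diag_block_mat (map X is)) z"
    using Cons by simp
  show ?case
    using quad_pencil_four_block_diag[OF A X As Xs, of z] A X As Xs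
      carrier_matD[OF quad_pencil_carrier[OF X, of "A i" z]]
      carrier_matD[OF quad_pencil_carrier[OF Xs, of "diag_block_mat (map A is)" z]]
    by (simp add: Let_def IH)
qed

section \<open>Commonly diagonalisable blocks\<close>

lemma inv_mat_inverse:
  assumes P: "P \<in> carrier_mat n n" and inv: "invertible_mat P"
  shows "inv_mat P \<in> carrier_mat n n" "P * inv_mat P = 1\<^sub>m n" "inv_mat P * P = 1\<^sub>m n"
proof -
  obtain B where B: "P * B = 1\<^sub>m (dim_row P)" "B * P = 1\<^sub>m (dim_row B)"
    using inv unfolding invertible_mat_def inverts_mat_def by auto
  \<comment> \<open>The inverse is not yet known to be square; comparing column counts in the two
    identities fixes its size.\<close>
  have "dim_row B = n"
    using arg_cong[OF B(2), of dim_col] P by simp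
  moreover have "dim_col B = n"
    using arg_cong[OF B(1), of dim_col] P by simp
  \<comment> \<open>\<open>mat_inverse\<close> returns \<open>None\<close> only for matrices that
    are not units of the matrix ring.\<close>
  ultimately have "P \<in> Units (ring_mat TYPE(complex) n ())"
    using B P unfolding Units_def by (auto simp: ring_mat_simps intro!: bexI[of _ B])
  then obtain R where "mat_inverse P = Some R"
    using mat_inverse(1)[OF P] by fastforce
  with mat_inverse(2)[OF P this]
  show "inv_mat P \<in> carrier_mat n n" "P * inv_mat P = 1\<^sub>m n" "inv_mat P * P = 1\<^sub>m n"
    by (auto simp: inv_mat_def)
qed

lemma cond_number_nonneg: "0 \<le> cond_number P"
  by (simp add: cond_number_def spectral_norm_nonneg)

text \<open>The quadratic formula, with \<open>d\<close> a square root of the discriminant. It is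
  applied to the diagonal entries of a diagonalised block pencil.\<close>

lemma monic_quadratic_split:
  fixes a x :: complex
  obtains r s where "\<And>z. z\<^sup>2 - z * a - x = (z - r) * (z - s)"
proof -
  define d where "d = csqrt (a\<^sup>2 + 4 * x)"
  have "x = (d\<^sup>2 - a\<^sup>2) / 4"
    by (simp add: d_def)
  then have "z\<^sup>2 - z * a - x = (z - (a + d) / 2) * (z - (a - d) / 2)" for z
    by (simp add: field_simps power2_eq_square)
  then show thesis by (rule that)
qed

lemma diagonal_mat_mult_vec_index:
  fixes D :: "'a :: semiring_0 mat"
  assumes "D \<in> carrier_mat n n" and "diagonal_mat D" and "v \<in> carrier_vec n" and "i < n"
  shows "(D *\<^sub>v v) $ i = D $$ (i, i) * v $ i"
proof -
  have "(D *\<^sub>v v) $ i = (\<Sum>j<n. D $$ (i, j) * v $ j)"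
    using assms by (auto simp: scalar_prod_def atLeast0LessThan)
  also have "\<dots> = (\<Sum>j<n. if j = i then D $$ (i, i) * v $ i else 0)"
    using assms by (intro sum.cong) (auto simp: diagonal_mat_def)
  finally show ?thesis using assms(4) by simp
qed

text \<open>Conjugation distributes over the three terms, and \<open>P * R = 1\<^sub>m n\<close>
  leaves the quadratic one unchanged.\<close>

lemma quad_pencil_similar:
  fixes A X P R :: "'a :: comm_ring_1 mat"
  assumes A: "A \<in> carrier_mat n n" and X: "X \<in> carrier_mat n n"
    and P: "P \<in> carrier_mat n n" and R: "R \<in> carrier_mat n n" and PR: "P * R = 1\<^sub>m n"
  shows "P * quad_pencil A X z * R = quad_pencil (P * A * R) (P * X * R) z"
  using assms
  by (simp add: quad_pencil_def mult_minus_distrib_mat[of _ n n _ n]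
      minus_mult_distrib_mat[of _ n n _ _ n] mult_smult_distrib[of _ n n _ n]
      mult_smult_assoc_mat[of _ n n _ n] minus_carrier_mat)

text \<open>Passing to the coordinates \<open>P *\<^sub>v v\<close> costs
  \<open>spectral_norm P\<close>, returning costs the norm of the inverse. The separation
  \<open>sep\<close> is phrased with kernel vectors of the block pencil because these can be padded
  to kernel vectors of the full pencil.\<close>

lemma quad_pencil_bounded_below:
  fixes A X P :: "complex mat"
  assumes A: "A \<in> carrier_mat n n" and X: "X \<in> carrier_mat n n"
    and P: "P \<in> carrier_mat n n" and inv: "invertible_mat P"
    and diagA: "diagonal_mat (P * A * inv_mat P)" and diagX: "diagonal_mat (P * X * inv_mat P)"
    and sep: "\<And>\<nu> w. w \<in> carrier_vec n \<Longrightarrow> w \<noteq> 0\<^sub>v n \<Longrightarrow> quad_pencil A X \<nu> *\<^sub>v w = 0\<^sub>v n \<Longrightarrow>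
      \<rho> \<le> cmod (\<mu> - \<nu>)"
    and \<rho>: "0 \<le> \<rho>" and v: "v \<in> carrier_vec n"
  shows "\<rho>\<^sup>2 * vec_norm2 v \<le> cond_number P * vec_norm2 (quad_pencil A X \<mu> *\<^sub>v v)"
proof -
  define R where "R = inv_mat P"
  have R: "R \<in> carrier_mat n n" and PR: "P * R = 1\<^sub>m n" and RP: "R * P = 1\<^sub>m n"
    unfolding R_def using inv_mat_inverse[OF P inv] by auto
  define D where "D z = quad_pencil (P * A * R) (P * X * R) z" for z
  have D: "D z \<in> carrier_mat n n" for z
    unfolding D_def using P X R by simp
  have D_sim: "D z = P * quad_pencil A X z * R" for z
    unfolding D_def using quad_pencil_similar[OF A X P R PR] by simp
  have D_diag: "diagonal_mat (D z)" for z
    using diagA diagX P A X R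
    unfolding D_def diagonal_mat_def quad_pencil_def R_def[symmetric] by auto
  \<comment> \<open>Intertwining by \<open>R\<close> carries kernel vectors of the diagonal pencil
    to kernel vectors of the original one; its counterpart \<open>PQ\<close> serves the norm
    estimate.\<close>
  have QR: "quad_pencil A X z * R = R * D z" for z
  proof -
    have "R * D z = R * (P * (quad_pencil A X z * R))"
      unfolding D_sim using assoc_mult_mat[OF P _ R] quad_pencil_carrier[OF X] by simp
    also have "\<dots> = quad_pencil A X z * R"
      using assoc_mult_mat[OF R P, of "quad_pencil A X z * R" n, symmetric]
        mult_carrier_mat[OF quad_pencil_carrier[OF X] R] RP
      by (simp add: left_mult_one_mat[of _ n n])
    finally show ?thesis ..
  qed
  have PQ: "P *\<^sub>v (quad_pencil A X z *\<^sub>v u) = D z *\<^sub>v (P *\<^sub>v u)" if u: "u \<in> carrier_vec n" for z u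
  proof -
    have "D z *\<^sub>v (P *\<^sub>v u) = P * quad_pencil A X z *\<^sub>v (R *\<^sub>v (P *\<^sub>v u))"
      unfolding D_sim by (rule assoc_mult_mat_vec)
        (use P R u quad_pencil_carrier[OF X] in \<open>auto intro: mult_carrier_mat\<close>)
    also have "R *\<^sub>v (P *\<^sub>v u) = u"
      using assoc_mult_mat_vec[OF R P u] RP u by simp
    finally show ?thesis
      using assoc_mult_mat_vec[OF P quad_pencil_carrier[OF X] u] by simp
  qed
  have entry: "\<rho>\<^sup>2 \<le> cmod (D \<mu> $$ (j, j))" if j: "j < n" for j
  proof -
    have D_entry: "D z $$ (j, j) = z\<^sup>2 - z * (P * A * R) $$ (j, j) - (P * X * R) $$ (j, j)" for z
      using j P A X R by (simp add: D_def quad_pencil_def del: index_mult_mat(1))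
    obtain r s where rs: "D z $$ (j, j) = (z - r) * (z - s)" for z
      using monic_quadratic_split[of "(P * A * R) $$ (j, j)" "(P * X * R) $$ (j, j)"]
      unfolding D_entry by blast
    \<comment> \<open>At a root of the \<open>j\<close>-th diagonal entry, \<open>D \<nu>\<close>
      annihilates the \<open>j\<close>-th unit vector, so the pencil annihilates its image under
      \<open>R\<close>. That image is nonzero because \<open>P\<close> maps it back to the unit
      vector.\<close>
    have root: "\<rho> \<le> cmod (\<mu> - \<nu>)" if "D \<nu> $$ (j, j) = 0" for \<nu>
    proof (rule sep)
      let ?w = "R *\<^sub>v unit_vec n j"
      show "?w \<in> carrier_vec n" using R by simp
      have "P *\<^sub>v ?w = unit_vec n j"
        using assoc_mult_mat_vec[OF P R, of "unit_vec n j"] PR by simp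
      moreover have "P *\<^sub>v 0\<^sub>v n = 0\<^sub>v n"
        using P by (intro eq_vecI) auto
      moreover have "unit_vec n j \<noteq> (0\<^sub>v n :: complex vec)"
        using j by (metis index_unit_vec(1) index_zero_vec(1) zero_neq_one)
      ultimately show "?w \<noteq> 0\<^sub>v n" by metis
      have "D \<nu> *\<^sub>v unit_vec n j = 0\<^sub>v n"
      proof (intro eq_vecI)
        fix i assume "i < dim_vec (0\<^sub>v n :: complex vec)"
        then show "(D \<nu> *\<^sub>v unit_vec n j) $ i = 0\<^sub>v n $ i"
          using diagonal_mat_mult_vec_index[OF D D_diag, of "unit_vec n j" i] that j
          by (cases "i = j") auto
      qed (use D in auto)
      moreover have "R *\<^sub>v 0\<^sub>v n = 0\<^sub>v n"
        using R by (intro eq_vecI) auto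
      ultimately show "quad_pencil A X \<nu> *\<^sub>v ?w = 0\<^sub>v n"
        using assoc_mult_mat_vec[OF quad_pencil_carrier[OF X, of A \<nu>] R, of "unit_vec n j"]
          assoc_mult_mat_vec[OF R D[of \<nu>], of "unit_vec n j"] QR[of \<nu>] by simp
    qed
    \<comment> \<open>Both \<open>r\<close> and \<open>s\<close> are roots of the entry, so each
      factor is at least \<rho>.\<close>
    have "\<rho> * \<rho> \<le> cmod (\<mu> - r) * cmod (\<mu> - s)"
      using \<rho> by (intro mult_mono root) (auto simp: rs)
    then show ?thesis
      by (simp add: rs norm_mult power2_eq_square)
  qed
  let ?q = "quad_pencil A X \<mu> *\<^sub>v v"
  have q: "?q \<in> carrier_vec n"
    using quad_pencil_carrier[OF X] v by (rule mult_mat_vec_carrier)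
  have Pv: "P *\<^sub>v v \<in> carrier_vec n" using P v by simp
  have "\<rho>\<^sup>2 * vec_norm2 (P *\<^sub>v v) \<le> vec_norm2 (D \<mu> *\<^sub>v (P *\<^sub>v v))"
  proof (rule vec_norm2_mono_scaled)
    fix i assume "i < dim_vec (D \<mu> *\<^sub>v (P *\<^sub>v v))"
    then have i: "i < n" using D[of \<mu>] by auto
    show "\<rho>\<^sup>2 * cmod ((P *\<^sub>v v) $ i) \<le> cmod ((D \<mu> *\<^sub>v (P *\<^sub>v v)) $ i)"
      unfolding diagonal_mat_mult_vec_index[OF D D_diag Pv i] norm_mult
      using entry[OF i] by (rule mult_right_mono) simp
  qed (use D[of \<mu>] P in auto)
  also have "\<dots> = vec_norm2 (P *\<^sub>v ?q)"
    unfolding PQ[OF v] ..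
  also have "\<dots> \<le> spectral_norm P * vec_norm2 ?q"
    using P q by (intro vec_norm2_mult_mat_vec_le) auto
  finally have *: "\<rho>\<^sup>2 * vec_norm2 (P *\<^sub>v v) \<le> spectral_norm P * vec_norm2 ?q" .
  \<comment> \<open>Recovering \<open>v\<close> from its coordinates supplies the second factor of
    the condition number.\<close>
  have "vec_norm2 v = vec_norm2 (R *\<^sub>v (P *\<^sub>v v))"
    using assoc_mult_mat_vec[OF R P v] RP v by simp
  also have "\<dots> \<le> spectral_norm R * vec_norm2 (P *\<^sub>v v)"
    using R Pv by (intro vec_norm2_mult_mat_vec_le) auto
  finally have "\<rho>\<^sup>2 * vec_norm2 v \<le> spectral_norm R * (\<rho>\<^sup>2 * vec_norm2 (P *\<^sub>v v))"
    using mult_left_mono[of "vec_norm2 v" "spectral_norm R * vec_norm2 (P *\<^sub>v v)" "\<rho>\<^sup>2"]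
    by (simp add: mult_ac)
  also have "\<dots> \<le> spectral_norm R * (spectral_norm P * vec_norm2 ?q)"
    using * spectral_norm_nonneg by (rule mult_left_mono)
  finally show ?thesis
    by (simp add: cond_number_def R_def mult_ac)
qed

section \<open>Eigenvalue perturbation for the companion matrices\<close>

theorem theorem2p1:
  fixes A A_hat X X_hat L L_hat :: "complex mat"
    and A_blk X_blk P :: "nat \<Rightarrow> complex mat"
    and n :: "nat \<Rightarrow> nat" and l N :: nat and \<mu> :: complex
  assumes "1 \<le> l"
    and "N = (\<Sum>i=1..l. n i)"
    and "A \<in> carrier_mat N N" and "X \<in> carrier_mat N N"
    and "\<And>i. i \<in> {1..l} \<Longrightarrow> A_blk i \<in> carrier_mat (n i) (n i)"
    and "\<And>i. i \<in> {1..l} \<Longrightarrow> X_blk i \<in> carrier_mat (n i) (n i)"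
    and "\<And>i. i \<in> {1..l} \<Longrightarrow> P i \<in> carrier_mat (n i) (n i)"
    and "A_hat = diag_block_mat (map A_blk [1..<l+1])"
    and "X_hat = diag_block_mat (map X_blk [1..<l+1])"
    and "\<And>i. i \<in> {1..l} \<Longrightarrow> invertible_mat (P i)"
    and "\<And>i. i \<in> {1..l} \<Longrightarrow> diagonal_mat (P i * A_blk i * inv_mat (P i))"
    and "\<And>i. i \<in> {1..l} \<Longrightarrow> diagonal_mat (P i * X_blk i * inv_mat (P i))"
    and "L = four_block_mat A X (1\<^sub>m N) (0\<^sub>m N N)"
    and "L_hat = four_block_mat A_hat X_hat (1\<^sub>m N) (0\<^sub>m N N)"
    and "eigenvalue L \<mu>"
  shows "\<exists>\<nu>. eigenvalue L_hat \<nu> \<and>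
    cmod (\<mu> - \<nu>) \<le> sqrt (MAX i\<in>{1..l}. cond_number (P i))
      * sqrt (spectral_norm (X - X_hat + \<mu> \<cdot>\<^sub>m (A - A_hat)))"
proof -
  let ?is = "[1..<l+1]"
  let ?E = "X - X_hat + \<mu> \<cdot>\<^sub>m (A - A_hat)"
  define \<kappa> where "\<kappa> = (MAX i\<in>{1..l}. cond_number (P i))"
  define Q where "Q z = map (\<lambda>i. quad_pencil (A_blk i) (X_blk i) z) ?is" for z
  have set_is: "set ?is = {1..l}" by auto
  have cond_le: "cond_number (P i) \<le> \<kappa>" if "i \<in> {1..l}" for i
    unfolding \<kappa>_def using that by (intro Max_ge) auto
  \<comment> \<open>Since \<open>1 \<le> l\<close>, the index 1 is in the range and the maximum
    dominates a nonnegative number.\<close>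
  have \<kappa>: "0 \<le> \<kappa>"
    using cond_le[of 1] cond_number_nonneg[of "P 1"] assms(1) by auto
  have "N = (\<Sum>i\<leftarrow>?is. n i)"
    unfolding assms(2) using set_is by (metis distinct_upt sum_list_distinct_conv_sum_set)
  then have blocks: "diag_block_mat (map B ?is) \<in> carrier_mat N N"
    if "\<And>i. i \<in> {1..l} \<Longrightarrow> B i \<in> carrier_mat (n i) (n i)" for B :: "nat \<Rightarrow> complex mat"
    using diag_block_mat_map_carrier[of ?is B n, unfolded set_is] that by simp
  have Ah: "A_hat \<in> carrier_mat N N" and Xh: "X_hat \<in> carrier_mat N N"
    unfolding assms(8,9) by (intro blocks assms(5,6); simp)+
  have Q_square: "square_mat B" if mem: "B \<in> set (Q z)" for B z
  proof -
    obtain i where i: "i \<in> {1..l}" and B: "B = quad_pencil (A_blk i) (X_blk i) z"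
      using mem unfolding Q_def set_map set_is by blast
    show ?thesis
      unfolding B using carrier_matD[OF quad_pencil_carrier[OF assms(6)[OF i]]] by simp
  qed
  have Q: "quad_pencil A_hat X_hat z = diag_block_mat (Q z)" for z
    unfolding Q_def assms(8,9) using assms(5,6)
    by (intro quad_pencil_diag_block_mat[of _ _ n]) auto
  have Q_dim: "dim_row (diag_block_mat (Q z)) = N" for z
    using quad_pencil_carrier[OF Xh, of A_hat z] unfolding Q by auto
  obtain v where v: "v \<in> carrier_vec N" "v \<noteq> 0\<^sub>v N" "quad_pencil A X \<mu> *\<^sub>v v = 0\<^sub>v N"
    using assms(15) unfolding assms(13) eigenvalue_companion_iff[OF assms(3,4)] by blast
  \<comment> \<open>For \<open>N = 0\<close> the spectrum of \<open>L_hat\<close> would be empty;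
    the nonzero \<open>v\<close> excludes this case.\<close>
  have N: "0 < N"
  proof (rule ccontr)
    assume "\<not> 0 < N"
    then have "v = 0\<^sub>v N" using v(1) by (intro eq_vecI) auto
    with v(2) show False by simp
  qed
  have Lh: "L_hat \<in> carrier_mat (N + N) (N + N)"
    unfolding assms(14) using Ah by (intro four_block_carrier_mat) auto
  \<comment> \<open>The witness is an eigenvalue of \<open>L_hat\<close> nearest to \<mu>. It exists
    because the spectrum is finite and nonempty, and its distance \<rho> bounds all other distances
    from below, as the block estimate requires.\<close>
  define S where "S = (\<lambda>\<nu>. cmod (\<mu> - \<nu>)) ` spectrum L_hat"
  have S: "finite S" "S \<noteq> {}"
    using card_finite_spectrum(1)[OF Lh] spectrum_non_empty[OF Lh] N by (auto simp: S_def)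
  obtain \<nu> where \<nu>: "eigenvalue L_hat \<nu>" "cmod (\<mu> - \<nu>) = Min S"
    using Min_in[OF S] unfolding S_def spectrum_def by auto
  define \<rho> where "\<rho> = cmod (\<mu> - \<nu>)"
  have \<rho>: "\<rho> \<le> cmod (\<mu> - \<nu>')" if "eigenvalue L_hat \<nu>'" for \<nu>'
    using that \<nu>(2) S(1) by (auto simp: \<rho>_def S_def spectrum_def)
  \<comment> \<open>The kernel vector of a block pencil extends to one of the pencil of
    \<open>A_hat\<close> and \<open>X_hat\<close>, which makes \<open>\<nu>'\<close> an eigenvalue
    of \<open>L_hat\<close>.\<close>
  have sep: "\<rho> \<le> cmod (\<mu> - \<nu>')"
    if i: "i \<in> {1..l}" and w: "w \<in> carrier_vec (n i)" "w \<noteq> 0\<^sub>v (n i)"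
      "quad_pencil (A_blk i) (X_blk i) \<nu>' *\<^sub>v w = 0\<^sub>v (n i)" for i \<nu>' w
  proof (rule \<rho>)
    have dim: "dim_row (quad_pencil (A_blk i) (X_blk i) \<nu>') = n i"
      using quad_pencil_carrier[OF assms(6)[OF i]] by auto
    have "quad_pencil (A_blk i) (X_blk i) \<nu>' \<in> set (Q \<nu>')"
      using i unfolding Q_def set_map set_is by blast
    from diag_block_mat_kernel[OF Q_square this, unfolded dim, OF _ w]
    show "eigenvalue L_hat \<nu>'"
      unfolding assms(14) eigenvalue_companion_iff[OF Ah Xh] Q Q_dim by auto
  qed
  have "\<rho>\<^sup>2 * vec_norm2 v \<le> \<kappa> * vec_norm2 (diag_block_mat (Q \<mu>) *\<^sub>v v)"
  proof (rule diag_block_mat_bounded_below[OF Q_square])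
    fix B and u :: "complex vec" assume "B \<in> set (Q \<mu>)" and u: "u \<in> carrier_vec (dim_row B)"
    then obtain i where i: "i \<in> {1..l}" and B: "B = quad_pencil (A_blk i) (X_blk i) \<mu>"
      unfolding Q_def set_map set_is by blast
    have "u \<in> carrier_vec (n i)"
      using u unfolding B carrier_matD[OF quad_pencil_carrier[OF assms(6)[OF i]]] .
    then have "\<rho>\<^sup>2 * vec_norm2 u \<le> cond_number (P i) * vec_norm2 (B *\<^sub>v u)"
      unfolding B using i assms(5-7) assms(10-12) sep[OF i]
      by (intro quad_pencil_bounded_below) (auto simp: \<rho>_def)
    \<comment> \<open>The condition number of the block gives way to the common maximum, the uniform
      constant under which blocks can be combined.\<close>
    also have "\<dots> \<le> \<kappa> * vec_norm2 (B *\<^sub>v u)"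
      using cond_le[OF i] by (rule mult_right_mono) simp
    finally show "\<rho>\<^sup>2 * vec_norm2 u \<le> \<kappa> * vec_norm2 (B *\<^sub>v u)" .
  qed (use \<kappa> v in \<open>auto simp: Q_dim\<close>)
  also have "diag_block_mat (Q \<mu>) *\<^sub>v v = ?E *\<^sub>v v"
  proof -
    \<comment> \<open>The two pencils differ by exactly \<open>?E\<close>, and the pencil of
      \<open>A\<close> and \<open>X\<close> annihilates \<open>v\<close>.\<close>
    have "quad_pencil A_hat X_hat \<mu> = quad_pencil A X \<mu> + ?E"
      using assms(3,4) Ah Xh
      by (intro eq_matI) (auto simp: quad_pencil_def algebra_simps)
    moreover have "?E \<in> carrier_mat N N"
      using Ah by (auto intro: minus_carrier_mat)
    ultimately show ?thesis
      using v quad_pencil_carrier[OF assms(4)]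
      by (simp add: Q[symmetric] add_mult_distrib_mat_vec[of _ N N])
  qed
  also have "vec_norm2 (?E *\<^sub>v v) \<le> spectral_norm ?E * vec_norm2 v"
    using v(1) Ah by (intro vec_norm2_mult_mat_vec_le) simp
  finally have "\<rho>\<^sup>2 * vec_norm2 v \<le> (\<kappa> * spectral_norm ?E) * vec_norm2 v"
    using \<kappa> by (simp add: mult_left_mono mult.assoc)
  moreover have "0 < vec_norm2 v"
    using v by (intro vec_norm2_pos) auto
  ultimately have "\<rho>\<^sup>2 \<le> \<kappa> * spectral_norm ?E"
    by simp
  then have "\<rho> \<le> sqrt \<kappa> * sqrt (spectral_norm ?E)"
    unfolding real_sqrt_mult[symmetric] by (rule real_le_rsqrt)
  then show ?thesis
    using \<nu>(1) unfolding \<rho>_def \<kappa>_def by blast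
qed

end
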